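(* Let $T:\mathbb{R}[x]\to\mathbb{R}[x]$ be an arbitrary linear operator, written as $$T=\sum_{k=0}^\infty Q_k(x)D^k,\qquad Q_k(x)\in\mathbb{R}[x].$$ For each $n\in\mathbb{Z}$ define the sequence $$\{b_{n,k}\}_{k=0}^\infty:=\left\{\sum_{j=0}^k\binom{k}{j}Q_{j+n}^{(j)}(0)\right\}_{k=0}^\infty,$$ where $Q_{j+n}^{(j)}(0)$ is taken to be $0$ when $n+j<0$, and define the classical diagonal differential operator $T_n$ by $T_n[x^k]:=b_{n,k}x^k$ for all $k\in\mathbb{N}_0$. Then $$T=\sum_{n=1}^{\infty} T_{-n}D^{-n} + \sum_{n=0}^\infty T_nD^n,$$ where $D\cdot D^{-1}=1$. Furthermore, this representation (with each $T_n$, $n\in\mathbb{Z}$, a classical diagonal differential operator) is unique.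
   Context: $\mathbb{N}_0=\{0,1,2,\ldots\}$ and $D:=\frac{d}{dx}$. Every linear operator $T:\mathbb{R}[x]\to\mathbb{R}[x]$ has a unique representation $T=\sum_{k=0}^\infty Q_k(x)D^k$ with $Q_k\in\mathbb{R}[x]$. $Q_k^{(j)}$ denotes the $j$-th derivative. A classical diagonal differential operator is a linear operator $S:\mathbb{R}[x]\to\mathbb{R}[x]$ with $S[x^k]=c_kx^k$ for every $k\in\mathbb{N}_0$, for some real sequence $\{c_k\}_{k=0}^\infty$; such an operator has a unique expansion $S=\sum_{k=0}^\infty \frac{a_k}{k!}x^kD^k$ with $a_k=\sum_{j=0}^k\binom{k}{j}c_j(-1)^{k-j}$. Meaning of $D^{-n}$: it is a formal symbol with $D^k\cdot D^{m}=D^{k+m}$ for all $k\in\mathbb{N}_0$, $m\in\mathbb{Z}$ (so $D\cdot D^{-1}=1$). Thus for $S=\sum_{k}\frac{a_k}{k!}x^kD^k$ and $n\in\mathbb{Z}$, $S\,D^{n}$ denotes the formal expression $\sum_{k=0}^\infty\frac{a_k}{k!}x^kD^{k+n}$, and the equality of $T$ with the two-sided sum is equality of formal series $\sum_{k\in\mathbb{N}_0,\,m\in\mathbb{Z}}a_{k,m}x^kD^m$, compared coefficientwise, where $T$ is the formal series $\sum_{m\ge 0}Q_m(x)D^m$. *)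

theory Defs
  imports "HOL-Computational_Algebra.Computational_Algebra"
begin

text \<open>
  \<open>real poly\<close> is not an instance of \<^class>\<open>real_vector\<close>, so linearity is taken with respect
  to \<^const>\<open>smult\<close>.
\<close>

abbreviation linear_op :: "(real poly \<Rightarrow> real poly) \<Rightarrow> bool" where
  "linear_op T \<equiv> Vector_Spaces.linear smult smult T"

text \<open>
  \<open>T = \<Sum>k. Q k D^k\<close>. The sum is finite at each \<open>p\<close>, as \<open>D^k p = 0\<close> for \<open>k > degree p\<close>.
\<close>

definition diff_expansion :: "(real poly \<Rightarrow> real poly) \<Rightarrow> (nat \<Rightarrow> real poly) \<Rightarrow> bool" where
  "diff_expansion T Q \<longleftrightarrow> (\<forall>p. T p = (\<Sum>k\<le>degree p. Q k * (pderiv ^^ k) p))"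

text \<open>Well-defined for linear \<open>T\<close> by \<open>diff_expansion_ex1\<close> below.\<close>

definition diff_coeffs :: "(real poly \<Rightarrow> real poly) \<Rightarrow> nat \<Rightarrow> real poly" where
  "diff_coeffs T = (THE Q. diff_expansion T Q)"

definition diag_op :: "(nat \<Rightarrow> real) \<Rightarrow> real poly \<Rightarrow> real poly" where
  "diag_op c p = (\<Sum>k\<le>degree p. monom (c k * coeff p k) k)"

definition classical_diagonal :: "(real poly \<Rightarrow> real poly) \<Rightarrow> bool" where
  "classical_diagonal S \<longleftrightarrow>
     linear_op S \<and> (\<exists>c. \<forall>k. S (monom 1 k) = smult (c k) (monom 1 k))"

text \<open>
  A formal series \<open>\<Sum>k m. F k m x^k D^m\<close> with \<open>k \<ge> 0\<close> and \<open>m\<close> an arbitrary integer is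
  represented by its coefficient array \<open>F\<close>.
\<close>

type_synonym dseries = "nat \<Rightarrow> int \<Rightarrow> real"

definition op_series :: "(real poly \<Rightarrow> real poly) \<Rightarrow> dseries" where
  "op_series T k m = (if m < 0 then 0 else coeff (diff_coeffs T (nat m)) k)"

text \<open>The formal product \<open>S D^n\<close>, with \<open>D^m D^n = D^(m + n)\<close>.\<close>

definition times_D_pow :: "(real poly \<Rightarrow> real poly) \<Rightarrow> int \<Rightarrow> dseries" where
  "times_D_pow S n k m = op_series S k (m - n)"

text \<open>
  Infinite formal sums are coefficientwise; each coefficient may receive only finitely many
  nonzero contributions.
\<close>

definition has_formal_sum :: "(int \<Rightarrow> dseries) \<Rightarrow> int set \<Rightarrow> dseries \<Rightarrow> bool" where
  "has_formal_sum F I G \<longleftrightarrow>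
     (\<forall>k m. finite {n \<in> I. F n k m \<noteq> 0} \<and> G k m = (\<Sum>n | n \<in> I \<and> F n k m \<noteq> 0. F n k m))"

definition diagonal_representation ::
    "(real poly \<Rightarrow> real poly) \<Rightarrow> (int \<Rightarrow> real poly \<Rightarrow> real poly) \<Rightarrow> bool" where
  "diagonal_representation T S \<longleftrightarrow>
     (\<forall>n. classical_diagonal (S n)) \<and>
     (\<exists>A B. has_formal_sum (\<lambda>n. times_D_pow (S (- n)) (- n)) {1..} A \<and>
            has_formal_sum (\<lambda>n. times_D_pow (S n) n) {0..} B \<and>
            op_series T = (\<lambda>k m. A k m + B k m))"

definition b_seq :: "(nat \<Rightarrow> real poly) \<Rightarrow> int \<Rightarrow> nat \<Rightarrow> real" where
  "b_seq Q n k = (\<Sum>j\<le>k. real (k choose j) *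
     (if n + int j < 0 then 0 else poly ((pderiv ^^ j) (Q (nat (int j + n)))) 0))"


lemma linear_op_iff:
  "linear_op T \<longleftrightarrow> (\<forall>p q. T (p + q) = T p + T q) \<and> (\<forall>c p. T (smult c p) = smult c (T p))"
proof -
  have "vector_space (smult :: real \<Rightarrow> _)"
    by unfold_locales (simp_all add: smult_add_right smult_add_left)
  then show ?thesis
    by (auto simp: Vector_Spaces.linear_def module_hom_def module_hom_axioms_def
        vector_space_def module_def)
qed

lemma pderiv_funpow_monom_self: "(pderiv ^^ n) (monom 1 n) = [:fact n :: real:]"
proof (rule poly_eqI)
  fix i
  show "coeff ((pderiv ^^ n) (monom 1 n)) i = coeff [:fact n :: real:] i"
    by (cases i) (simp_all add: coeff_higher_pderiv pochhammer_fact)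
qed

lemma pderiv_funpow_eq_0: "degree p < n \<Longrightarrow> (pderiv ^^ n) p = 0" for p :: "real poly"
  by (rule poly_eqI) (simp add: coeff_higher_pderiv coeff_eq_0)

lemma diff_sum_extend:
  fixes p :: "real poly"
  assumes "degree p \<le> N"
  shows "(\<Sum>k\<le>degree p. Q k * (pderiv ^^ k) p) = (\<Sum>k\<le>N. Q k * (pderiv ^^ k) p)"
  by (rule sum.mono_neutral_left) (use assms in \<open>auto simp: pderiv_funpow_eq_0\<close>)

lemma linear_op_diff_sum: "linear_op (\<lambda>p. \<Sum>k\<le>degree p. Q k * (pderiv ^^ k) p)"
proof -
  let ?L = "\<lambda>p. \<Sum>k\<le>degree p. Q k * (pderiv ^^ k) p"
  have "?L (p + q) = ?L p + ?L q" for p q :: "real poly"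
  proof -
    define N where "N = max (degree p) (degree q)"
    have "degree (p + q) \<le> N" "degree p \<le> N" "degree q \<le> N"
      by (auto simp: N_def degree_add_le_max)
    from this[THEN diff_sum_extend] show ?thesis
      by (simp add: higher_pderiv_add distrib_left sum.distrib)
  qed
  moreover have "?L (smult c p) = smult c (?L p)" for c p
    by (cases "c = 0")
       (simp_all add: higher_pderiv_smult sum_distrib_left[of "[:c:]", simplified])
  ultimately show ?thesis by (simp add: linear_op_iff)
qed

lemma linear_op_eqI:
  assumes "linear_op S" "linear_op T" "\<And>k. S (monom 1 k) = T (monom 1 k)"
  shows "S = T"
proof
  fix p :: "real poly"
  have *: "L (\<Sum>i\<in>A. f i) = (\<Sum>i\<in>A. L (f i))" if "linear_op L"
    for L and A :: "nat set" and f
  proof -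
    have "L (smult 0 0) = smult 0 (L 0)"
      using that unfolding linear_op_iff by blast
    then show ?thesis
      using that by (induction A rule: infinite_finite_induct) (simp_all add: linear_op_iff)
  qed
  have eq: "L p = (\<Sum>i\<le>degree p. smult (coeff p i) (L (monom 1 i)))" if "linear_op L" for L
  proof -
    have "L p = L (\<Sum>i\<le>degree p. smult (coeff p i) (monom 1 i))"
      by (simp add: smult_monom poly_as_sum_of_monoms)
    also have "\<dots> = (\<Sum>i\<le>degree p. smult (coeff p i) (L (monom 1 i)))"
      using that by (subst *) (simp_all add: linear_op_iff)
    finally show ?thesis .
  qed
  show "S p = T p"
    by (simp add: eq assms)
qed

lemma diff_expansion_monom:
  assumes "diff_expansion T Q"
  shows "T (monom 1 n) = smult (fact n) (Q n) + (\<Sum>k<n. Q k * (pderiv ^^ k) (monom 1 n))"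
  using assms
  by (simp add: diff_expansion_def degree_monom_eq pderiv_funpow_monom_self
      flip: lessThan_Suc_atMost)

fun expansion_coeff :: "(real poly \<Rightarrow> real poly) \<Rightarrow> nat \<Rightarrow> real poly" where
  "expansion_coeff T n = smult (1 / fact n)
     (T (monom 1 n) - (\<Sum>k\<leftarrow>[0..<n]. expansion_coeff T k * (pderiv ^^ k) (monom 1 n)))"

declare expansion_coeff.simps [simp del]

theorem diff_expansion_ex1:
  assumes "linear_op T"
  shows "\<exists>!Q. diff_expansion T Q"
proof
  let ?Q = "expansion_coeff T"
  have "T = (\<lambda>p. \<Sum>k\<le>degree p. ?Q k * (pderiv ^^ k) p)"
  proof (rule linear_op_eqI[OF assms linear_op_diff_sum])
    fix n
    have "smult (fact n) (?Q n) =
        T (monom 1 n) - (\<Sum>k<n. ?Q k * (pderiv ^^ k) (monom 1 n))"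
      by (subst expansion_coeff.simps) (simp add: interv_sum_list_conv_sum_set_nat atLeast0LessThan)
    then show "T (monom 1 n) =
        (\<Sum>k\<le>degree (monom 1 n :: real poly). ?Q k * (pderiv ^^ k) (monom 1 n))"
      by (simp add: degree_monom_eq pderiv_funpow_monom_self flip: lessThan_Suc_atMost)
  qed
  then show "diff_expansion T ?Q"
    by (auto simp: diff_expansion_def dest: fun_cong)
next
  fix Q
  assume Q: "diff_expansion T Q"
  show "Q = expansion_coeff T"
  proof
    fix n
    show "Q n = expansion_coeff T n"
    proof (induction n rule: less_induct)
      case (less n)
      have "(\<Sum>k<n. Q k * (pderiv ^^ k) (monom 1 n)) =
          (\<Sum>k<n. expansion_coeff T k * (pderiv ^^ k) (monom 1 n))"
        by (rule sum.cong) (use less in auto)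
      then show ?case
        using diff_expansion_monom[OF Q, of n]
        by (subst expansion_coeff.simps)
           (simp add: interv_sum_list_conv_sum_set_nat atLeast0LessThan)
    qed
  qed
qed

lemma diff_coeffs_eq:
  assumes "linear_op T" "diff_expansion T Q"
  shows "diff_coeffs T = Q"
  unfolding diff_coeffs_def
  by (rule the1_equality[where P = "diff_expansion T"]) (use assms diff_expansion_ex1 in auto)

lemma coeff_diag_op: "coeff (diag_op c p) i = c i * coeff p i"
  by (auto simp: diag_op_def coeff_sum coeff_eq_0)

lemma classical_diagonal_diag_op: "classical_diagonal (diag_op c)"
  unfolding classical_diagonal_def linear_op_iff
  by (auto intro!: exI[of _ c] poly_eqI simp: coeff_diag_op algebra_simps)

lemma diag_op_unique:
  assumes "linear_op S" "\<And>k. S (monom 1 k) = smult (c k) (monom 1 k)"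
  shows "S = diag_op c"
  by (rule linear_op_eqI)
     (use assms classical_diagonal_diag_op[of c] in
       \<open>auto intro!: poly_eqI simp: classical_diagonal_def coeff_diag_op\<close>)

end

theory Submission
  imports Defs
begin

text \<open>
  A diagonal operator with eigenvalues \<open>c\<close> has the expansion \<open>\<Sum>k. (a k / k!) x^k D^k\<close>, where \<open>a\<close>
  is the inverse binomial transform of \<open>c\<close>, that is, \<open>c k = (\<Sum>j\<le>k. (k choose j) * a j)\<close>; this is
  \<open>diff_coeffs_diag_op\<close>. All exponent pairs of such an operator lie on the diagonal of the grid
  \<open>\<nat> \<times> \<int>\<close>, and multiplication by \<open>D^n\<close> moves them to the line \<open>m = n + k\<close>. These lines, for
  \<open>n \<in> \<int>\<close>, partition the grid. In \<open>\<Sum>n. T\<^sub>n D^n\<close> the monomials \<open>x^k D^m\<close> therefore never meet: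
  the monomial \<open>x^k D^m\<close> comes from the summand \<open>n = m - k\<close> alone, with coefficient \<open>a\<^sub>n k / k!\<close>.

  Hence \<open>diagonal_representation_iff\<close>: the \<open>T\<^sub>n\<close> represent \<open>T\<close> if and only if every coefficient of
  \<open>x^k D^(n + k)\<close> in \<open>T\<close> is \<open>a\<^sub>n k / k!\<close>. This says that \<open>a\<^sub>n k\<close> is \<open>k!\<close> times the \<open>k\<close>-th
  coefficient of \<open>Q (n + k)\<close>, which is the \<open>k\<close>-th derivative of \<open>Q (n + k)\<close> at \<open>0\<close>, so that the
  eigenvalues of \<open>T\<^sub>n\<close> are \<open>b_seq Q n\<close>. As every eigenvalue sequence is a binomial transform, the
  equivalence gives both existence and uniqueness.
\<close>

definition binomial_transform :: "(nat \<Rightarrow> real) \<Rightarrow> nat \<Rightarrow> real" where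
  "binomial_transform a k = (\<Sum>j\<le>k. real (k choose j) * a j)"

text \<open>
  On exponential generating functions the binomial transform is multiplication by the unit
  \<open>exp x\<close>.
\<close>

lemma surj_binomial_transform: "surj binomial_transform"
proof (rule surjI)
  fix c :: "nat \<Rightarrow> real"
  define C where "C = Abs_fps (\<lambda>k. c k / fact k)"
  define A where "A = C * fps_exp (- 1)"
  have "A * fps_exp 1 = C"
    by (simp add: A_def mult.assoc flip: fps_exp_add_mult)
  show "binomial_transform (\<lambda>k. fact k * fps_nth (Abs_fps (\<lambda>k. c k / fact k) * fps_exp (- 1)) k) = c"
  proof
    fix k
    have "c k = fact k * fps_nth (A * fps_exp 1) k"
      by (simp add: \<open>A * fps_exp 1 = C\<close> C_def)
    also have "\<dots> = (\<Sum>j\<le>k. real (k choose j) * (fact j * fps_nth A j))"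
      by (simp add: fps_mult_nth sum_distrib_left binomial_fact atLeast0AtMost)
    finally show "binomial_transform
        (\<lambda>k. fact k * fps_nth (Abs_fps (\<lambda>k. c k / fact k) * fps_exp (- 1)) k) k = c k"
      by (simp add: binomial_transform_def A_def C_def)
  qed
qed

text \<open>
  The binomial coefficient is the reason why the eigenvalues of \<open>\<Sum>k. (a k / k!) x^k D^k\<close> are the
  binomial transform of \<open>a\<close>.
\<close>

lemma coeff_monom_times_pderiv_funpow:
  fixes p :: "real poly"
  shows "coeff (monom (r / fact k) k * (pderiv ^^ k) p) i = real (i choose k) * r * coeff p i"
proof (cases "k \<le> i")
  case True
  have "pochhammer (real (Suc (i - k))) k = fact i / fact (i - k)"
    using True pochhammer_product[of "i - k" i "1 :: real"]
    by (simp add: field_simps of_nat_diff flip: pochhammer_fact)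
  with True show ?thesis
    by (simp add: coeff_monom_mult coeff_higher_pderiv binomial_fact)
next
  case False
  then show ?thesis
    by (simp add: coeff_monom_mult binomial_eq_0)
qed

lemma diff_coeffs_diag_op:
  "diff_coeffs (diag_op (binomial_transform a)) = (\<lambda>k. monom (a k / fact k) k)"
proof (rule diff_coeffs_eq)
  show "linear_op (diag_op (binomial_transform a))"
    using classical_diagonal_diag_op by (simp add: classical_diagonal_def)
  show "diff_expansion (diag_op (binomial_transform a)) (\<lambda>k. monom (a k / fact k) k)"
    unfolding diff_expansion_def
  proof (intro allI poly_eqI)
    fix p :: "real poly" and i
    have "(\<Sum>k\<le>degree p. real (i choose k) * a k) * coeff p i
        = (\<Sum>k\<le>i. real (i choose k) * a k) * coeff p i"
    proof (cases "i \<le> degree p")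
      case True
      then have "(\<Sum>k\<le>i. real (i choose k) * a k) = (\<Sum>k\<le>degree p. real (i choose k) * a k)"
        by (intro sum.mono_neutral_left) auto
      then show ?thesis
        by simp
    next
      case False
      then show ?thesis
        by (simp add: coeff_eq_0)
    qed
    then show "coeff (diag_op (binomial_transform a) p) i
        = coeff (\<Sum>k\<le>degree p. monom (a k / fact k) k * (pderiv ^^ k) p) i"
      by (simp add: coeff_diag_op binomial_transform_def coeff_sum
          coeff_monom_times_pderiv_funpow sum_distrib_right)
  qed
qed

lemma times_D_pow_diag_op:
  "times_D_pow (diag_op (binomial_transform a)) n k m
     = (if n = m - int k then a k / fact k else 0)"
  by (auto simp: times_D_pow_def op_series_def diff_coeffs_diag_op)

lemma has_formal_sum_disjoint_supports:
  assumes "\<And>n k m. F n k m \<noteq> 0 \<Longrightarrow> n = f k m"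
  shows "has_formal_sum F I G \<longleftrightarrow> G = (\<lambda>k m. if f k m \<in> I then F (f k m) k m else 0)"
proof -
  have "{n \<in> I. F n k m \<noteq> 0} = (if f k m \<in> I \<and> F (f k m) k m \<noteq> 0 then {f k m} else {})" for k m
    using assms by auto
  then have "finite {n \<in> I. F n k m \<noteq> 0}
      \<and> (\<Sum>n | n \<in> I \<and> F n k m \<noteq> 0. F n k m) = (if f k m \<in> I then F (f k m) k m else 0)"
    for k m
    by simp
  then show ?thesis
    by (simp only: has_formal_sum_def fun_eq_iff simp_thms)
qed

text \<open>
  Comparing \<open>T\<close> with \<open>\<Sum>n. T\<^sub>n D^n\<close> involves no cancellation, so that the comparison determines each
  \<open>a n k\<close> by a single coefficient of \<open>T\<close>.
\<close>

lemma diagonal_representation_iff: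
  "diagonal_representation T (\<lambda>n. diag_op (binomial_transform (a n)))
     \<longleftrightarrow> (\<forall>n k. a n k = fact k * op_series T k (n + int k))"
proof -
  define E where "E k m = a (m - int k) k / fact k" for k m
  have A: "has_formal_sum
        (\<lambda>n. times_D_pow (diag_op (binomial_transform (a (- n)))) (- n)) {1..} A
      \<longleftrightarrow> A = (\<lambda>k m. if int k - m \<ge> 1 then E k m else 0)" for A
    by (subst has_formal_sum_disjoint_supports[where f = "\<lambda>k m. int k - m"])
       (auto simp: times_D_pow_diag_op E_def cong: if_cong split: if_splits)
  have B: "has_formal_sum (\<lambda>n. times_D_pow (diag_op (binomial_transform (a n))) n) {0..} B
      \<longleftrightarrow> B = (\<lambda>k m. if m - int k \<ge> 0 then E k m else 0)" for B
    by (subst has_formal_sum_disjoint_supports[where f = "\<lambda>k m. m - int k"])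
       (auto simp: times_D_pow_diag_op E_def cong: if_cong split: if_splits)
  have "(\<lambda>k m. (if int k - m \<ge> 1 then E k m else 0) + (if m - int k \<ge> 0 then E k m else 0)) = E"
    by (auto simp: fun_eq_iff)
  then have "diagonal_representation T (\<lambda>n. diag_op (binomial_transform (a n)))
      \<longleftrightarrow> op_series T = E"
    unfolding diagonal_representation_def A B by (simp add: classical_diagonal_diag_op)
  also have "\<dots> \<longleftrightarrow> (\<forall>n k. a n k = fact k * op_series T k (n + int k))"
  proof
    assume "op_series T = E"
    then show "\<forall>n k. a n k = fact k * op_series T k (n + int k)"
      by (simp add: E_def)
  next
    assume "\<forall>n k. a n k = fact k * op_series T k (n + int k)"
    then show "op_series T = E"
      by (simp add: E_def fun_eq_iff)
  qed
  finally show ?thesis .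
qed

lemma b_seq_eq_binomial_transform:
  assumes "linear_op T" and "diff_expansion T Q"
  shows "b_seq Q n = binomial_transform (\<lambda>j. fact j * op_series T j (n + int j))"
proof -
  have "poly ((pderiv ^^ j) p) 0 = fact j * coeff p j" for j and p :: "real poly"
    by (simp add: poly_0_coeff_0 coeff_higher_pderiv pochhammer_fact)
  then show ?thesis
    by (auto simp: fun_eq_iff b_seq_def binomial_transform_def op_series_def
        diff_coeffs_eq[OF assms] add.commute intro!: sum.cong)
qed

lemma classical_diagonal_obtains_binomial_transform:
  assumes "classical_diagonal S"
  obtains a where "S = diag_op (binomial_transform a)"
proof -
  from assms obtain c where "S = diag_op c"
    unfolding classical_diagonal_def using diag_op_unique by blast
  moreover obtain a where "c = binomial_transform a"
    using surj_binomial_transform by (rule surjE)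
  ultimately show thesis
    using that by blast
qed

theorem theorem19:
  fixes T :: "real poly \<Rightarrow> real poly" and Q :: "nat \<Rightarrow> real poly"
  assumes "linear_op T" and "diff_expansion T Q"
  shows "diagonal_representation T (\<lambda>n. diag_op (b_seq Q n)) \<and>
         (\<forall>S. diagonal_representation T S \<longrightarrow> S = (\<lambda>n. diag_op (b_seq Q n)))"
proof (intro conjI allI impI)
  note b_seq = b_seq_eq_binomial_transform[OF assms]
  show "diagonal_representation T (\<lambda>n. diag_op (b_seq Q n))"
    unfolding b_seq diagonal_representation_iff by simp
  fix S
  assume S: "diagonal_representation T S"
  then have "\<forall>n. \<exists>a. S n = diag_op (binomial_transform a)"
    unfolding diagonal_representation_def
    by (blast elim: classical_diagonal_obtains_binomial_transform)
  then obtain a where a: "S = (\<lambda>n. diag_op (binomial_transform (a n)))"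
    by (metis ext)
  with S have "a n = (\<lambda>k. fact k * op_series T k (n + int k))" for n
    by (simp add: diagonal_representation_iff fun_eq_iff)
  with a show "S = (\<lambda>n. diag_op (b_seq Q n))"
    by (simp add: b_seq)
qed

end
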